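(* The diagram $\mathbf{E}_8^{(7)}$ has exactly $3$ orbits of labelings: 1. the orbit of zero, consisting of the labelings with an odd number of components (including the component of the boxed 1), excluding the fixed labeling $\ell'_2$; 2. the fixed labeling $\ell'_2$ with $a_6=a_8=1$ and all other $a_i=0$; 3. the orbit consisting of all the labelings with an even number of components (including the component of the boxed 1), with representative the labeling with $a_2=a_4=a_6=1$ and all other $a_i=0$.
   Context: $\mathbf{E}_8^{(7)}$ is the Dynkin diagram $\mathbf{E}_8$ with vertices $1,\dots,8$, edges $\{1,2\},\{2,3\},\{3,4\},\{4,5\},\{5,6\},\{6,7\},\{5,8\}$, with vertex $7$ colored black. A labeling is $\boldsymbol a=(a_1,\dots,a_8)\in(\mathbb{Z}/2\mathbb{Z})^8$. The augmented diagram is obtained by adding one extra vertex (the "boxed 1"), joined by an edge to vertex $7$ only, carrying the constant label $1$. For $1\le i\le 8$ the move $\mathcal{M}_i$ changes only $a_i$, replacing it by $a_i$ plus the sum (in $\mathbb{Z}/2\mathbb{Z}$) of the labels of all neighbors of $i$ in the augmented diagram (including the boxed 1 when $i=7$). There is no move at the boxed vertex. Orbits are the equivalence classes of labelings under finite sequences of moves; a fixed labeling is one fixed by all moves (so it forms an orbit by itself). Components of a labeling are the connected components of the subgraph of the augmented diagram induced on the vertices with label $1$, the boxed vertex included. *)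

theory Defs
  imports "HOL-Library.FuncSet" "HOL-Library.Z2"
begin

definition vertices :: "nat set" where
  "vertices = {1..8}"

definition E8_edges :: "nat set set" where
  "E8_edges = {{1,2}, {2,3}, {3,4}, {4,5}, {5,6}, {6,7}, {5,8}}"

text \<open>The extra vertex of the augmented diagram (the boxed 1) is the number 0;
  it is attached to the black vertex 7 only.\<close>

definition boxed :: nat where
  "boxed = 0"

definition black :: nat where
  "black = 7"

definition aug_vertices :: "nat set" where
  "aug_vertices = insert boxed vertices"

definition aug_edges :: "nat set set" where
  "aug_edges = insert {boxed, black} E8_edges"

definition neighbors :: "nat \<Rightarrow> nat set" where
  "neighbors i = {j \<in> aug_vertices. {i, j} \<in> aug_edges}"

text \<open>Labelings are the elements of $(\mathbb{Z}/2\mathbb{Z})^8$, as extensional functions on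
  the vertex set, so that equality of labelings is equality of functions.\<close>

type_synonym labeling = "nat \<Rightarrow> bit"

definition labelings :: "labeling set" where
  "labelings = vertices \<rightarrow>\<^sub>E UNIV"

text \<open>The labeling with label 1 exactly at the vertices in \<open>X\<close>.\<close>

definition labeling_of :: "nat set \<Rightarrow> labeling" where
  "labeling_of X = (\<lambda>i\<in>vertices. if i \<in> X then 1 else 0)"

definition aug_label :: "labeling \<Rightarrow> nat \<Rightarrow> bit" where
  "aug_label a = a(boxed := 1)"

definition move :: "nat \<Rightarrow> labeling \<Rightarrow> labeling" where
  "move i a = a(i := a i + (\<Sum>j\<in>neighbors i. aug_label a j))"

definition move_rel :: "(labeling \<times> labeling) set" where
  "move_rel = {(a, move i a) | a i. a \<in> labelings \<and> i \<in> vertices}"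

text \<open>Each move is an involution, so reachability by finitely many moves is already an
  equivalence relation on labelings (\<open>equiv_orbit_rel\<close> below).\<close>

definition orbit_rel :: "(labeling \<times> labeling) set" where
  "orbit_rel = move_rel\<^sup>* \<inter> (labelings \<times> labelings)"

definition orbit :: "labeling \<Rightarrow> labeling set" where
  "orbit a = orbit_rel `` {a}"

definition orbits :: "labeling set set" where
  "orbits = labelings // orbit_rel"

definition fixed_labeling :: "labeling \<Rightarrow> bool" where
  "fixed_labeling a \<longleftrightarrow> a \<in> labelings \<and> (\<forall>i\<in>vertices. move i a = a)"

definition support :: "labeling \<Rightarrow> nat set" where
  "support a = {v \<in> aug_vertices. aug_label a v = 1}"

definition support_adj :: "labeling \<Rightarrow> (nat \<times> nat) set" where
  "support_adj a = {(u, v) \<in> support a \<times> support a. {u, v} \<in> aug_edges}"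

text \<open>Vertex sets of the connected components of the subgraph induced on \<open>support a\<close>:
  the classes of \<open>support a\<close> under joinability by a path inside \<open>support a\<close>.\<close>

definition components :: "labeling \<Rightarrow> nat set set" where
  "components a = support a // (support_adj a)\<^sup>*"

definition num_components :: "labeling \<Rightarrow> nat" where
  "num_components a = card (components a)"

lemma move_in_labelings:
  assumes "a \<in> labelings" "i \<in> vertices"
  shows "move i a \<in> labelings"
  using assms by (auto simp: labelings_def move_def PiE_iff extensional_def)

lemma not_own_neighbor: "i \<notin> neighbors i"
  by (auto simp: neighbors_def aug_edges_def E8_edges_def boxed_def black_def doubleton_eq_iff)

lemma move_move: "move i (move i a) = a"
proof -
  define s where "s = (\<Sum>j\<in>neighbors i. aug_label a j)"
  have a: "move i a = a(i := a i + s)"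
    by (simp only: move_def s_def)
  have "(\<Sum>j\<in>neighbors i. aug_label (move i a) j) = s"
    unfolding s_def a
    by (rule sum.cong) (use not_own_neighbor in \<open>auto simp: aug_label_def\<close>)
  then have "move i (move i a) = (move i a)(i := move i a i + s)"
    by (simp only: move_def[of i "move i a"])
  also have "\<dots> = a(i := a i + (s + s))"
    by (simp only: a fun_upd_upd fun_upd_same add.assoc)
  also have "s + s = 0"
    by (cases s) simp_all
  finally show ?thesis
    by (simp only: add_0_right fun_upd_triv)
qed

lemma sym_move_rel: "sym move_rel"
proof (rule symI)
  fix a b assume "(a, b) \<in> move_rel"
  then obtain i where i: "i \<in> vertices" "a \<in> labelings" "b = move i a"
    by (auto simp: move_rel_def)
  then have "(move i a, move i (move i a)) \<in> move_rel"
    unfolding move_rel_def using move_in_labelings by blast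
  then show "(b, a) \<in> move_rel"
    by (simp only: i(3) move_move)
qed

lemma equiv_orbit_rel: "equiv labelings orbit_rel"
proof (rule equivI)
  show "orbit_rel \<subseteq> labelings \<times> labelings"
    by (auto simp: orbit_rel_def)
  show "refl_on labelings orbit_rel"
    by (auto simp: orbit_rel_def refl_on_def)
  show "sym orbit_rel"
    using sym_rtrancl[OF sym_move_rel] by (auto simp: orbit_rel_def sym_def)
  show "trans orbit_rel"
    by (auto simp: orbit_rel_def trans_def)
qed

end

theory Submission
  imports Defs
begin

text \<open>The augmented diagram is a tree, so a move that changes the label of a vertex with \<open>d\<close>
  labelled neighbours (\<open>d\<close> odd) changes the number of components by \<open>d - 1\<close>: the parity of that
  number is invariant. Conversely, every component can be shrunk to a single vertex (the boxed one to
  the boxed vertex), an isolated labelled vertex can slide along the diagram, and three components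
  meeting at the branch vertex 5 can be merged. Playing this until nothing gets smaller leaves only
  the labelings supported on \<open>{}\<close>, \<open>{8}\<close> and \<open>{6, 8}\<close>.\<close>

section \<open>Counting components of a forest\<close>

text \<open>Every component contains exactly one vertex whose parent lies outside \<open>S\<close>.\<close>

lemma card_quotient_forest:
  fixes p :: "'a \<Rightarrow> 'a" and rank :: "'a \<Rightarrow> nat"
  assumes rank: "\<And>v. v \<in> S \<Longrightarrow> p v \<in> S \<Longrightarrow> rank (p v) < rank v"
  assumes E: "E = {(u, v) \<in> S \<times> S. p u = v \<or> p v = u}"
  shows "card (S // E\<^sup>*) = card {v \<in> S. p v \<notin> S}"
proof -
  \<comment> \<open>\<open>r v\<close> is the first vertex on the way up from \<open>v\<close> whose
    parent lies outside \<open>S\<close>: the root of the component of \<open>v\<close>.\<close>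
  define n where "n v = (LEAST k. p ((p ^^ k) v) \<notin> S)" for v
  define r where "r v = (p ^^ n v) v" for v
  have ex: "\<exists>k. p ((p ^^ k) v) \<notin> S" if "v \<in> S" for v
    using that
  proof (induction "rank v" arbitrary: v rule: less_induct)
    case less
    show ?case
    proof (cases "p v \<in> S")
      case True
      then obtain k where "p ((p ^^ k) (p v)) \<notin> S"
        using less rank by blast
      then have "p ((p ^^ Suc k) v) \<notin> S"
        by (simp only: funpow_Suc_right o_apply not_False_eq_True)
      then show ?thesis ..
    next
      case False
      then have "p ((p ^^ 0) v) \<notin> S"
        by simp
      then show ?thesis ..
    qed
  qed
  have r_root: "r v = v" if "p v \<notin> S" for v
    using that Least_eq_0[of "\<lambda>k. p ((p ^^ k) v) \<notin> S"] by (simp add: r_def n_def)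
  have r_parent: "r (p v) = r v" if "v \<in> S" "p v \<in> S" for v
  proof -
    obtain k where k: "p ((p ^^ k) v) \<notin> S"
      using ex[OF \<open>v \<in> S\<close>] by blast
    \<comment> \<open>\<open>Least_Suc\<close> needs failure at 0, which is
      \<open>p v \<in> S\<close>; so the climb from \<open>v\<close> is exactly one step longer than
      from \<open>p v\<close>.\<close>
    have "n v = Suc (LEAST k. p ((p ^^ Suc k) v) \<notin> S)"
      unfolding n_def by (rule Least_Suc[of "\<lambda>k. p ((p ^^ k) v) \<notin> S", OF k]) (use that in simp)
    then have "n v = Suc (n (p v))"
      unfolding n_def by (simp only: funpow_Suc_right o_apply)
    then show ?thesis
      by (simp only: r_def funpow_Suc_right o_apply)
  qed
  have r_reach: "(v, r v) \<in> E\<^sup>* \<and> r v \<in> S \<and> p (r v) \<notin> S" if "v \<in> S" for v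
    using that
  proof (induction "rank v" arbitrary: v rule: less_induct)
    case less
    show ?case
    proof (cases "p v \<in> S")
      case True
      moreover from this have "(v, p v) \<in> E"
        using less.prems by (auto simp: E)
      ultimately show ?thesis
        using less rank r_parent by (metis converse_rtrancl_into_rtrancl)
    qed (use less.prems r_root in auto)
  qed
  have r_invar: "v \<in> S \<and> r v = r u" if "(u, v) \<in> E\<^sup>*" "u \<in> S" for u v
    using that by (induction rule: rtrancl_induct) (auto simp: E r_parent dest: r_parent)
  have "sym E"
    by (auto simp: E sym_def)
  then have sym: "(v, u) \<in> E\<^sup>*" if "(u, v) \<in> E\<^sup>*" for u v
    using that by (meson sym_rtrancl symD)
  \<comment> \<open>Components are the fibres of \<open>r\<close>: edges preserve \<open>r\<close>,
    and vertices with the same root are joined through it.\<close>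
  have cls: "E\<^sup>* `` {u} = {v \<in> S. r v = r u}" if "u \<in> S" for u
  proof -
    have "(u, v) \<in> E\<^sup>*" if "v \<in> S" "r v = r u" for v
      using r_reach[OF \<open>u \<in> S\<close>] sym r_reach[OF \<open>v \<in> S\<close>] \<open>r v = r u\<close> by (metis rtrancl_trans)
    then show ?thesis
      using r_invar that by auto
  qed
  have "S // E\<^sup>* = (\<lambda>t. {v \<in> S. r v = t}) ` {v \<in> S. p v \<notin> S}"
  proof -
    have "S // E\<^sup>* = (\<lambda>u. {v \<in> S. r v = r u}) ` S"
      using cls by (auto simp: quotient_def)
    also have "\<dots> = (\<lambda>t. {v \<in> S. r v = t}) ` (r ` S)"
      by (simp add: image_image)
    also have "r ` S = {v \<in> S. p v \<notin> S}"
      using r_reach r_root by (auto simp: image_iff) metis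
    finally show ?thesis .
  qed
  moreover have "inj_on (\<lambda>t. {v \<in> S. r v = t}) {v \<in> S. p v \<notin> S}"
  proof (rule inj_onI)
    fix x y
    assume x: "x \<in> {v \<in> S. p v \<notin> S}" and "{v \<in> S. r v = x} = {v \<in> S. r v = y}"
    then have "r x = x \<longleftrightarrow> r x = y"
      by blast
    with x r_root show "x = y"
      by simp
  qed
  ultimately show ?thesis
    by (simp add: card_image)
qed

section \<open>Parity of the number of components\<close>

lemma vertices_eq: "vertices = {1, 2, 3, 4, 5, 6, 7, 8}"
  by (auto simp: vertices_def)

lemma aug_vertices_eq: "aug_vertices = {0, 1, 2, 3, 4, 5, 6, 7, 8}"
  by (simp add: aug_vertices_def boxed_def vertices_eq)

text \<open>The augmented tree rooted at the boxed vertex, whose parent 9 is outside the diagram.\<close>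

definition parent :: "nat \<Rightarrow> nat" where
  "parent v = (if v = 0 then 9 else if v = 7 then 0 else if v = 8 then 5 else v + 1)"

definition depth :: "nat \<Rightarrow> nat" where
  "depth v = (if v = 0 then 0 else if v = 8 then 4 else 8 - v)"

lemma aug_edges_iff_parent:
  "u \<in> aug_vertices \<Longrightarrow> v \<in> aug_vertices \<Longrightarrow> {u, v} \<in> aug_edges \<longleftrightarrow> parent u = v \<or> parent v = u"
  unfolding aug_vertices_eq
  by (elim insertE emptyE)
    (simp_all add: aug_edges_def E8_edges_def boxed_def black_def doubleton_eq_iff parent_def)

lemma num_components_eq: "num_components a = card {v \<in> support a. parent v \<notin> support a}"
  unfolding num_components_def components_def
proof (rule card_quotient_forest)
  show "depth (parent v) < depth v" if "v \<in> support a" "parent v \<in> support a" for v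
    using that by (auto simp: support_def aug_vertices_eq parent_def depth_def)
  show "support_adj a = {(u, v) \<in> support a \<times> support a. parent u = v \<or> parent v = u}"
    using aug_edges_iff_parent by (auto simp: support_adj_def support_def)
qed

text \<open>Component roots counted modulo 2: \<open>a v * (1 + a (parent v))\<close> is 1 exactly
  when \<open>v\<close> is a root. The leading 1 is the boxed vertex; 7 has no term because its
  parent always carries 1.\<close>

definition parity :: "labeling \<Rightarrow> bit" where
  "parity a = 1 + a 6 * (1 + a 7) + a 5 * (1 + a 6) + a 4 * (1 + a 5)
     + a 3 * (1 + a 4) + a 2 * (1 + a 3) + a 1 * (1 + a 2) + a 8 * (1 + a 5)"

lemma of_nat_num_components: "of_nat (num_components a) = parity a"
proof -
  \<comment> \<open>The value \<open>a 9\<close> is unspecified even for labelings; 9, the parent of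
    the boxed vertex, gets 0 so that the boxed vertex counts as a root.\<close>
  let ?x = "\<lambda>v. if v = 9 then 0 else aug_label a v"
  have "of_nat (num_components a) =
      (\<Sum>v\<in>{v \<in> aug_vertices. v \<in> support a \<and> parent v \<notin> support a}. 1 :: bit)"
    unfolding num_components_eq by (simp add: support_def)
  also have "\<dots> = (\<Sum>v\<in>aug_vertices. if v \<in> support a \<and> parent v \<notin> support a then 1 else 0)"
    by (rule sum.inter_filter) (simp add: aug_vertices_eq)
  also have "\<dots> = (\<Sum>v\<in>aug_vertices. ?x v * (1 + ?x (parent v)))"
    by (rule sum.cong) (auto simp: support_def aug_vertices_eq parent_def)
  also have "\<dots> = parity a"
    \<comment> \<open>With these deletions the vertex 1 is not rewritten to \<open>Suc 0\<close>,
      and sums and products of bits stay ring operations.\<close>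
    by (simp add: aug_vertices_eq parent_def aug_label_def boxed_def parity_def add_ac
        del: One_nat_def add_bit_eq_xor mult_bit_eq_and)
  finally show ?thesis .
qed

lemma even_num_components_iff: "even (num_components a) \<longleftrightarrow> parity a = 0"
  unfolding of_nat_num_components[symmetric]
  using even_of_nat_iff[of "num_components a", where 'a = bit] by simp

lemma neighbors_eq:
  "neighbors 1 = {2}" "neighbors 2 = {1, 3}" "neighbors 3 = {2, 4}" "neighbors 4 = {3, 5}"
  "neighbors 5 = {4, 6, 8}" "neighbors 6 = {5, 7}" "neighbors 7 = {0, 6}" "neighbors 8 = {5}"
  by (auto simp: neighbors_def aug_vertices_eq aug_edges_def E8_edges_def boxed_def black_def
      doubleton_eq_iff)

lemma move_eq:
  "move 1 a = a(1 := a 1 + a 2)"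
  "move 2 a = a(2 := a 2 + (a 1 + a 3))"
  "move 3 a = a(3 := a 3 + (a 2 + a 4))"
  "move 4 a = a(4 := a 4 + (a 3 + a 5))"
  "move 5 a = a(5 := a 5 + (a 4 + (a 6 + a 8)))"
  "move 6 a = a(6 := a 6 + (a 5 + a 7))"
  "move 7 a = a(7 := a 7 + (1 + a 6))"
  "move 8 a = a(8 := a 8 + a 5)"
  by (simp_all add: move_def neighbors_eq aug_label_def boxed_def del: One_nat_def)

text \<open>Cancellation of repeated terms and squares, also inside AC-sorted chains;
  \<open>parity_move\<close> thereby becomes a comparison of polynomial normal forms over
  Z/2.\<close>

lemma bit_idem:
  fixes b c :: bit
  shows "b + b = 0" "b + (b + c) = c" "b * b = b" "b * (b * c) = b * c"
  by (cases b; cases c; simp)+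

lemma parity_move: "i \<in> vertices \<Longrightarrow> parity (move i a) = parity a"
  unfolding vertices_eq
  by (elim insertE emptyE; hypsubst)
    (simp_all add: move_eq parity_def algebra_simps bit_idem
      del: One_nat_def add_bit_eq_xor mult_bit_eq_and)

lemma parity_orbit_rel:
  assumes "(a, b) \<in> orbit_rel"
  shows "parity b = parity a"
proof -
  have "(a, b) \<in> move_rel\<^sup>*"
    using assms by (simp add: orbit_rel_def)
  then show ?thesis
    by induction (auto simp: move_rel_def parity_move)
qed

section \<open>Reduction to minimal labelings\<close>

text \<open>Words of moves are lists, head applied first, so that their effect can be computed by
  simplification.\<close>

lemma fold_move_orbit_rel:
  "a \<in> labelings \<Longrightarrow> set ws \<subseteq> vertices \<Longrightarrow> (a, fold move ws a) \<in> orbit_rel"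
proof (induction ws arbitrary: a)
  case Nil
  then show ?case
    by (simp add: orbit_rel_def)
next
  case (Cons i ws)
  then have i: "i \<in> vertices" and "(move i a, fold move ws (move i a)) \<in> orbit_rel"
    by (simp_all add: move_in_labelings)
  moreover from Cons.prems(1) i have "(a, move i a) \<in> move_rel"
    by (auto simp: move_rel_def)
  ultimately show ?case
    using Cons.prems(1) by (auto simp: orbit_rel_def intro: converse_rtrancl_into_rtrancl)
qed

text \<open>The weights of all vertices but 7 increase with the distance from 8, so that
  sliding a label towards 8 decreases the total.\<close>

definition weight :: "labeling \<Rightarrow> nat" where
  "weight a = of_bool (a 8 = 1) + 2 * of_bool (a 5 = 1) + 3 * of_bool (a 4 = 1)
     + 4 * of_bool (a 3 = 1) + 5 * of_bool (a 2 = 1) + 6 * of_bool (a 1 = 1)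
     + 3 * of_bool (a 6 = 1) + of_bool (a 7 = 1)"

lemma labeling_of_eqI:
  assumes "a \<in> labelings" "\<And>v. v \<in> vertices \<Longrightarrow> a v = (if v \<in> X then 1 else 0)"
  shows "a = labeling_of X"
  using assms by (auto simp: labelings_def labeling_of_def PiE_iff extensional_def fun_eq_iff)

lemma labeling_of_in_labelings: "labeling_of X \<in> labelings"
  by (simp add: labelings_def labeling_of_def)

text \<open>Every word of moves that would lower the weight rules out a pattern of labels; the words
  below leave only three supports.\<close>

lemma minimal_labelings:
  assumes a: "a \<in> labelings"
    and "\<And>b. (a, b) \<in> orbit_rel \<Longrightarrow> weight a \<le> weight b"
  shows "a \<in> {labeling_of {}, labeling_of {8}, labeling_of {6, 8}}"
proof -
  have min: "weight a \<le> weight (fold move ws a)" if "set ws \<subseteq> vertices" for ws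
    using assms that fold_move_orbit_rel by blast
  note eval = weight_def move_eq vertices_eq
  \<comment> \<open>A move at a labelled vertex with an odd number of labelled neighbours erases its
    label and lowers the weight, so that number is even; for 7 it includes the boxed vertex.\<close>
  have isolated1: "a 1 = 1 \<Longrightarrow> a 2 = 0"
    using min[of "[1]"] by (cases "a 1"; cases "a 2") (simp_all add: eval del: One_nat_def)
  have isolated2: "a 2 = 1 \<Longrightarrow> a 1 = a 3"
    using min[of "[2]"]
    by (cases "a 1"; cases "a 2"; cases "a 3") (simp_all add: eval del: One_nat_def)
  have isolated3: "a 3 = 1 \<Longrightarrow> a 2 = a 4"
    using min[of "[3]"]
    by (cases "a 2"; cases "a 3"; cases "a 4") (simp_all add: eval del: One_nat_def)
  have isolated4: "a 4 = 1 \<Longrightarrow> a 3 = a 5"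
    using min[of "[4]"]
    by (cases "a 3"; cases "a 4"; cases "a 5") (simp_all add: eval del: One_nat_def)
  have isolated5: "a 5 = 1 \<Longrightarrow> a 4 + a 6 + a 8 = 0"
    using min[of "[5]"]
    by (cases "a 4"; cases "a 5"; cases "a 6"; cases "a 8") (simp_all add: eval del: One_nat_def)
  have isolated6: "a 6 = 1 \<Longrightarrow> a 5 = a 7"
    using min[of "[6]"]
    by (cases "a 5"; cases "a 6"; cases "a 7") (simp_all add: eval del: One_nat_def)
  have isolated7: "a 7 = 1 \<Longrightarrow> a 6 = 1"
    using min[of "[7]"] by (cases "a 6"; cases "a 7") (simp_all add: eval del: One_nat_def)
  have isolated8: "a 8 = 1 \<Longrightarrow> a 5 = 0"
    using min[of "[8]"] by (cases "a 5"; cases "a 8") (simp_all add: eval del: One_nat_def)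
  \<comment> \<open>Induction from the leaf 1: if both ends of an edge are labelled, evenness at the
    end nearer to 1 makes the preceding edge labelled too (at 5, \<open>isolated8\<close> rules out
    8).\<close>
  have edge12: "a 1 = 0 \<or> a 2 = 0"
    using isolated1 by (cases "a 1"; cases "a 2") simp_all
  have edge23: "a 2 = 0 \<or> a 3 = 0"
    using isolated2 edge12 by (cases "a 1"; cases "a 2"; cases "a 3") simp_all
  have edge34: "a 3 = 0 \<or> a 4 = 0"
    using isolated3 edge23 by (cases "a 2"; cases "a 3"; cases "a 4") simp_all
  have edge45: "a 4 = 0 \<or> a 5 = 0"
    using isolated4 edge34 by (cases "a 3"; cases "a 4"; cases "a 5") simp_all
  have edge56: "a 5 = 0 \<or> a 6 = 0"
    using isolated5 isolated8 edge45
    by (cases "a 4"; cases "a 5"; cases "a 6"; cases "a 8") simp_all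
  have a7: "a 7 = 0"
    using isolated6 isolated7 edge56 by (cases "a 5"; cases "a 6"; cases "a 7") simp_all
  \<comment> \<open>Moves at \<open>w\<close>, then \<open>v\<close>, slide an isolated label from
    \<open>v\<close> to a neighbour \<open>w\<close> whose other neighbours are unlabelled: here 5
    to 8, then 3 to 4 and 1 to 2.\<close>
  have a5: "a 5 = 0"
    using a7 isolated8 edge45 edge56 min[of "[8, 5]"]
    by (cases "a 4"; cases "a 5"; cases "a 6"; cases "a 7"; cases "a 8")
      (simp_all add: eval del: One_nat_def)
  have a3: "a 3 = 0"
    using a5 edge23 edge34 min[of "[4, 3]"] by (cases "a 2"; cases "a 3"; cases "a 4"; cases "a 5")
      (simp_all add: eval del: One_nat_def)
  have a1: "a 1 = 0"
    using a3 edge12 min[of "[2, 1]"] by (cases "a 1"; cases "a 2"; cases "a 3")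
      (simp_all add: eval del: One_nat_def)
  \<comment> \<open>The slides from 2, 4 and 6 can be blocked only by a label at another neighbour
    of the target.\<close>
  have slide2: "a 2 = 1 \<Longrightarrow> a 4 = 1"
    using a1 a3 min[of "[3, 2]"] by (cases "a 1"; cases "a 2"; cases "a 3"; cases "a 4")
      (simp_all add: eval del: One_nat_def)
  have slide4: "a 4 = 1 \<Longrightarrow> a 6 = 1 \<or> a 8 = 1"
    using a3 a5 min[of "[5, 4]"]
    by (cases "a 3"; cases "a 4"; cases "a 5"; cases "a 6"; cases "a 8")
      (simp_all add: eval del: One_nat_def)
  have slide6: "a 6 = 1 \<Longrightarrow> a 4 = 1 \<or> a 8 = 1"
    using a5 a7 min[of "[5, 6]"]
    by (cases "a 4"; cases "a 5"; cases "a 6"; cases "a 7"; cases "a 8")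
      (simp_all add: eval del: One_nat_def)
  have no_decrease: False if "weight (fold move ws a) < weight a" "set ws \<subseteq> vertices" for ws
    using min that by fastforce
  \<comment> \<open>Move 5 joins 4, 6 and 8 into one component, which then shrinks to 4.\<close>
  have merge468: "\<not> (a 4 = 1 \<and> a 6 = 1 \<and> a 8 = 1)"
  proof
    assume "a 4 = 1 \<and> a 6 = 1 \<and> a 8 = 1"
    with a1 a3 a5 a7 show False
      by (intro no_decrease[of "[5, 8, 6, 5]"])
        (simp_all add: eval del: One_nat_def)
  qed
  \<comment> \<open>The boxed component grows along 7, 6, absorbs 4 and 8 through 5, and shrinks back.\<close>
  have merge48: "\<not> (a 4 = 1 \<and> a 6 = 0 \<and> a 8 = 1)"
  proof
    assume "a 4 = 1 \<and> a 6 = 0 \<and> a 8 = 1"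
    with a1 a3 a5 a7 show False
      by (intro no_decrease[of "[7, 6, 5, 4, 8, 5, 6, 7]"])
        (cases "a 2", simp_all add: eval del: One_nat_def)
  qed
  \<comment> \<open>Park 4 at 2 so that 6 can slide to 8, bring 2 back to 4, and proceed as before.\<close>
  have merge46: "\<not> (a 2 = 0 \<and> a 4 = 1 \<and> a 6 = 1 \<and> a 8 = 0)"
  proof
    assume "a 2 = 0 \<and> a 4 = 1 \<and> a 6 = 1 \<and> a 8 = 0"
    with a1 a3 a5 a7 show False
      by (intro no_decrease[of "[3, 4, 2, 3, 5, 6, 8, 5, 3, 2, 4, 3, 7, 6, 5, 4, 8, 5, 6, 7]"])
        (simp_all add: eval del: One_nat_def)
  qed
  \<comment> \<open>As before with 4 parked at 3 and 2 at 1; the label left at 1 finally slides to 8.\<close>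
  have merge246: "\<not> (a 2 = 1 \<and> a 4 = 1 \<and> a 6 = 1 \<and> a 8 = 0)"
  proof
    assume "a 2 = 1 \<and> a 4 = 1 \<and> a 6 = 1 \<and> a 8 = 0"
    with a1 a3 a5 a7 show False
      by (intro no_decrease[of "[1, 2, 3, 4, 5, 6, 8, 5, 4, 3, 7, 6, 5, 4, 8, 5, 6, 7,
          2, 1, 3, 2, 4, 3, 5, 4, 8, 5]"])
        (simp_all add: eval del: One_nat_def)
  qed
  \<comment> \<open>By \<open>slide4\<close> a label at 4 comes with one at 6 or 8; the four merges
    exclude every such case.\<close>
  have a4: "a 4 = 0"
    using slide4 merge468 merge48 merge46 merge246
    by (cases "a 2"; cases "a 4"; cases "a 6"; cases "a 8") simp_all
  have a2: "a 2 = 0"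
    using slide2 a4 by (cases "a 2") simp_all
  have "a 6 = 1 \<Longrightarrow> a 8 = 1"
    using slide6 a4 by simp
  then consider "a 6 = 0" "a 8 = 0" | "a 6 = 0" "a 8 = 1" | "a 6 = 1" "a 8 = 1"
    by (cases "a 6"; cases "a 8") simp_all
  then show ?thesis
  proof cases
    case 1
    then have "a = labeling_of {}"
      using a1 a2 a3 a4 a5 a7 by (intro labeling_of_eqI[OF a]) (auto simp: vertices_eq)
    then show ?thesis by simp
  next
    case 2
    then have "a = labeling_of {8}"
      using a1 a2 a3 a4 a5 a7 by (intro labeling_of_eqI[OF a]) (auto simp: vertices_eq)
    then show ?thesis by simp
  next
    case 3
    then have "a = labeling_of {6, 8}"
      using a1 a2 a3 a4 a5 a7 by (intro labeling_of_eqI[OF a]) (auto simp: vertices_eq)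
    then show ?thesis by simp
  qed
qed

lemma orbit_rel_minimal:
  assumes "a \<in> labelings"
  obtains b where "(a, b) \<in> orbit_rel" "b \<in> {labeling_of {}, labeling_of {8}, labeling_of {6, 8}}"
proof -
  have "(a, a) \<in> orbit_rel"
    using assms by (simp add: orbit_rel_def)
  then obtain b where b: "(a, b) \<in> orbit_rel"
    and min: "\<And>c. (a, c) \<in> orbit_rel \<Longrightarrow> weight b \<le> weight c"
    using ex_has_least_nat[of "\<lambda>b. (a, b) \<in> orbit_rel" a weight] by blast
  have "b \<in> {labeling_of {}, labeling_of {8}, labeling_of {6, 8}}"
  proof (rule minimal_labelings)
    show "b \<in> labelings"
      using b by (simp add: orbit_rel_def)
    show "weight b \<le> weight c" if "(b, c) \<in> orbit_rel" for c
      using min b that equiv_orbit_rel by (meson equivE transD)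
  qed
  with b show thesis
    by (rule that)
qed

section \<open>The three orbits and their separation\<close>

lemma labeling_of_apply:
  "v \<in> vertices \<Longrightarrow> labeling_of X v = (if v \<in> X then 1 else 0)"
  by (simp add: labeling_of_def)

lemma parity_labeling_of:
  "parity (labeling_of {}) = 1" "parity (labeling_of {8}) = 0"
  "parity (labeling_of {6, 8}) = 1" "parity (labeling_of {2, 4, 6}) = 0"
  by (simp_all add: parity_def labeling_of_apply vertices_eq)

text \<open>Every vertex has an even number of labelled neighbours: 5 sees 6 and 8, 7 sees 6 and the
  boxed vertex, the others see none.\<close>

lemma fixed_labeling_68: "fixed_labeling (labeling_of {6, 8})"
  unfolding fixed_labeling_def
proof (intro conjI ballI labeling_of_in_labelings)
  show "move i (labeling_of {6, 8}) = labeling_of {6, 8}" if "i \<in> vertices" for i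
    using that unfolding vertices_eq
    by (elim insertE emptyE; hypsubst)
      (simp_all add: move_eq labeling_of_apply vertices_eq fun_upd_idem del: One_nat_def)
qed

lemma orbit_fixed_labeling:
  assumes "fixed_labeling a"
  shows "orbit a = {a}"
proof -
  have "b = a" if "(a, b) \<in> move_rel\<^sup>*" for b
    using that by induction (use assms in \<open>auto simp: move_rel_def fixed_labeling_def\<close>)
  then show ?thesis
    using assms by (auto simp: orbit_def orbit_rel_def fixed_labeling_def)
qed

theorem proposition13p2:
  shows "card orbits = 3
    \<and> orbits = {orbit (labeling_of {}), {labeling_of {6, 8}}, orbit (labeling_of {2, 4, 6})}
    \<and> orbit (labeling_of {}) =
        {a \<in> labelings. odd (num_components a)} - {labeling_of {6, 8}}
    \<and> fixed_labeling (labeling_of {6, 8})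
    \<and> orbit (labeling_of {2, 4, 6}) = {a \<in> labelings. even (num_components a)}"
proof -
  let ?Z = "labeling_of {}" and ?F = "labeling_of {6, 8}" and ?T = "labeling_of {2, 4, 6}"
  have F: "orbit ?F = {?F}"
    by (rule orbit_fixed_labeling[OF fixed_labeling_68])
  have eq: "orbit a = orbit b \<longleftrightarrow> b \<in> orbit a" if "a \<in> labelings" "b \<in> labelings" for a b
    using eq_equiv_class_iff[OF equiv_orbit_rel that] by (simp add: orbit_def)
  have mem: "a \<in> orbit a" if "a \<in> labelings" for a
    using eq[OF that that] by simp
  have orbit_sub: "b \<in> labelings \<and> parity b = parity a" if "b \<in> orbit a" for a b
    using that parity_orbit_rel[of a b] by (simp add: orbit_def orbit_rel_def)
  \<comment> \<open>Reducing to \<open>?F\<close> means being \<open>?F\<close>, as its orbit is a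
    singleton.\<close>
  have reduce: "orbit a = orbit ?Z \<or> orbit a = orbit (labeling_of {8}) \<or> a = ?F"
    if a: "a \<in> labelings" for a
  proof -
    obtain b where b: "(a, b) \<in> orbit_rel" "b \<in> {?Z, labeling_of {8}, ?F}"
      using orbit_rel_minimal[OF a] .
    then have "orbit a = orbit b"
      using eq[OF a] labeling_of_in_labelings by (auto simp: orbit_def)
    then show ?thesis
      using mem[OF a] b(2) F by auto
  qed
  \<comment> \<open>Among the alternatives of \<open>reduce\<close> for \<open>?T\<close>, parity
    excludes \<open>?Z\<close> and \<open>?F\<close>; this replaces an explicit word of
    moves.\<close>
  have T8: "orbit (labeling_of {8}) = orbit ?T"
  proof -
    have "?T \<notin> orbit ?Z"
      using orbit_sub[of ?T ?Z] parity_labeling_of by auto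
    moreover have "?T \<noteq> ?F"
      using parity_labeling_of by (metis zero_neq_one)
    ultimately show ?thesis
      using reduce mem labeling_of_in_labelings by metis
  qed
  have even: "orbit ?T = {a \<in> labelings. parity a = 0}"
  proof (intro equalityI subsetI)
    fix a assume "a \<in> {a \<in> labelings. parity a = 0}"
    then have a: "a \<in> labelings" "parity a = 0"
      by simp_all
    then have "a \<notin> orbit ?Z" "a \<noteq> ?F"
      using orbit_sub[of a ?Z] parity_labeling_of by auto
    then show "a \<in> orbit ?T"
      using reduce[OF a(1)] mem[OF a(1)] T8 by auto
  qed (use orbit_sub[of _ ?T] parity_labeling_of in auto)
  have neq: "?F \<noteq> ?Z"
    using labeling_of_apply[of 6 "{6, 8}"] labeling_of_apply[of 6 "{}"] by (auto simp: vertices_eq)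
  \<comment> \<open>Both labelings have parity 1, so only the singleton orbit of \<open>?F\<close>
    separates them.\<close>
  then have FZ: "?F \<notin> orbit ?Z"
    using eq[of ?Z ?F] F mem[of ?Z] labeling_of_in_labelings by auto
  have odd: "orbit ?Z = {a \<in> labelings. parity a \<noteq> 0} - {?F}"
  proof (intro equalityI subsetI)
    fix a assume "a \<in> {a \<in> labelings. parity a \<noteq> 0} - {?F}"
    then have a: "a \<in> labelings" "a \<noteq> ?F" "a \<notin> orbit ?T"
      using even by auto
    then show "a \<in> orbit ?Z"
      using reduce[OF a(1)] mem[OF a(1)] T8 by auto
  qed (use orbit_sub[of _ ?Z] parity_labeling_of FZ in auto)
  have orbits: "orbits = {orbit ?Z, {?F}, orbit ?T}"
  proof -
    have "orbits = orbit ` labelings"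
      by (auto simp: orbits_def quotient_def orbit_def)
    also have "\<dots> = {orbit ?Z, {?F}, orbit ?T}"
      using reduce T8 F labeling_of_in_labelings by (auto simp: image_iff)
    finally show ?thesis .
  qed
  have "orbit ?Z \<noteq> {?F}" "{?F} \<noteq> orbit ?T" "orbit ?Z \<noteq> orbit ?T"
    using FZ F even orbit_sub[of ?F ?T] parity_labeling_of mem[of ?F] mem[of ?Z]
      labeling_of_in_labelings by force+
  then have "card orbits = 3"
    unfolding orbits by simp
  with orbits even odd fixed_labeling_68 show ?thesis
    by (simp add: even_num_components_iff)
qed

end
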